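(* Let $d\geq 2$ and let $R$ be the map $R(X)=\frac{1}{d-1}\left(\mathrm{Tr}(X)\,\mathbb{1}-X\right)$ on $d\times d$ complex matrices. Define the linear map on operators on $\mathbb{C}^d\otimes\mathbb{C}^d\otimes\mathbb{C}^d$ (parties $A,B,C$) $$\Phi_R[\rho]=(R_A\otimes I_{BC})[\rho]+(I_A\otimes R_B\otimes I_C)[\rho]+(I_{AB}\otimes R_C)[\rho]+c\,\mathrm{Tr}(\rho)\,\mathbb{1}.$$ For $c=\frac{2}{d}$, $\Phi_R[\rho]\geq 0$ for every tripartite biseparable state $\rho$ on $\mathbb{C}^d\otimes\mathbb{C}^d\otimes\mathbb{C}^d$.
   Context: $I$ denotes the identity map on operators of the indicated subsystems, $\mathbb{1}$ the identity operator, and the subscript on $R$ indicates the party on which it acts. "$\geq 0$" means positive semidefinite. A state is a positive semidefinite operator of trace one. A tripartite state is biseparable if it is a finite convex combination of states, each of which is a product state $\rho_S\otimes\rho_{\bar S}$ with respect to some bipartition $S|\bar S$ of $\{A,B,C\}$ into two non-empty parts (different terms may use different bipartitions). *)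

theory Defs
  imports "HOL-Analysis.Analysis"
begin

type_synonym 'n cmat = "complex^'n^'n"

definition hermitian :: "('n::finite) cmat \<Rightarrow> bool" where
  "hermitian X \<longleftrightarrow> (\<forall>i j. X $ i $ j = cnj (X $ j $ i))"

definition cinner :: "complex^('n::finite) \<Rightarrow> complex^'n \<Rightarrow> complex" where
  "cinner u v = (\<Sum>i\<in>UNIV. cnj (u $ i) * v $ i)"

text \<open>For Hermitian \<open>X\<close> the number \<open>cinner v (X *v v)\<close> is real, so taking the real part
  loses nothing.\<close>

definition psd :: "('n::finite) cmat \<Rightarrow> bool" where
  "psd X \<longleftrightarrow> hermitian X \<and> (\<forall>v. 0 \<le> Re (cinner v (X *v v)))"

definition is_state :: "('n::finite) cmat \<Rightarrow> bool" where
  "is_state \<rho> \<longleftrightarrow> psd \<rho> \<and> trace \<rho> = 1"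

text \<open>\<open>mat (trace X)\<close> is \<open>trace X\<close> times the identity matrix.\<close>

definition R_map :: "('d::finite) cmat \<Rightarrow> 'd cmat" where
  "R_map X = (1 / (real CARD('d) - 1)) *\<^sub>R (mat (trace X) - X)"

text \<open>The space of the parties \<open>A\<close>, \<open>B\<close>, \<open>C\<close> has the product basis indexed by triples.
  For linear \<open>L\<close>, \<open>on_A L\<close> is \<open>L \<otimes> I\<^sub>B\<^sub>C\<close>: \<open>L\<close> is applied to each block obtained by fixing
  the row and column indices of the other two parties. Similarly for \<open>on_B\<close> and \<open>on_C\<close>.\<close>

definition on_A ::
  "('a cmat \<Rightarrow> 'a cmat) \<Rightarrow> ('a::finite \<times> 'b::finite \<times> 'c::finite) cmat \<Rightarrow> ('a \<times> 'b \<times> 'c) cmat" where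
  "on_A L X = vec_lambda (\<lambda>(a, b, c). vec_lambda (\<lambda>(a', b', c').
     L (\<chi> i j. X $ (i, b, c) $ (j, b', c')) $ a $ a'))"

definition on_B ::
  "('b cmat \<Rightarrow> 'b cmat) \<Rightarrow> ('a::finite \<times> 'b::finite \<times> 'c::finite) cmat \<Rightarrow> ('a \<times> 'b \<times> 'c) cmat" where
  "on_B L X = vec_lambda (\<lambda>(a, b, c). vec_lambda (\<lambda>(a', b', c').
     L (\<chi> i j. X $ (a, i, c) $ (a', j, c')) $ b $ b'))"

definition on_C ::
  "('c cmat \<Rightarrow> 'c cmat) \<Rightarrow> ('a::finite \<times> 'b::finite \<times> 'c::finite) cmat \<Rightarrow> ('a \<times> 'b \<times> 'c) cmat" where
  "on_C L X = vec_lambda (\<lambda>(a, b, c). vec_lambda (\<lambda>(a', b', c').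
     L (\<chi> i j. X $ (a, b, i) $ (a', b', j)) $ c $ c'))"

definition Phi_R :: "real \<Rightarrow> ('d::finite \<times> 'd \<times> 'd) cmat \<Rightarrow> ('d \<times> 'd \<times> 'd) cmat" where
  "Phi_R c \<rho> = on_A R_map \<rho> + on_B R_map \<rho> + on_C R_map \<rho> + c *\<^sub>R mat (trace \<rho>)"

text \<open>Tensor products \<open>\<sigma> \<otimes> \<tau>\<close> for the bipartitions \<open>A|BC\<close>, \<open>B|AC\<close> and \<open>C|AB\<close>, with the factors
  sorted back into the order \<open>A\<close>, \<open>B\<close>, \<open>C\<close>.\<close>

definition tensor_A_BC ::
  "'a cmat \<Rightarrow> ('b \<times> 'c) cmat \<Rightarrow> ('a::finite \<times> 'b::finite \<times> 'c::finite) cmat" where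
  "tensor_A_BC \<sigma> \<tau> = vec_lambda (\<lambda>(a, b, c). vec_lambda (\<lambda>(a', b', c').
     \<sigma> $ a $ a' * \<tau> $ (b, c) $ (b', c')))"

definition tensor_B_AC ::
  "'b cmat \<Rightarrow> ('a \<times> 'c) cmat \<Rightarrow> ('a::finite \<times> 'b::finite \<times> 'c::finite) cmat" where
  "tensor_B_AC \<sigma> \<tau> = vec_lambda (\<lambda>(a, b, c). vec_lambda (\<lambda>(a', b', c').
     \<sigma> $ b $ b' * \<tau> $ (a, c) $ (a', c')))"

definition tensor_C_AB ::
  "'c cmat \<Rightarrow> ('a \<times> 'b) cmat \<Rightarrow> ('a::finite \<times> 'b::finite \<times> 'c::finite) cmat" where
  "tensor_C_AB \<sigma> \<tau> = vec_lambda (\<lambda>(a, b, c). vec_lambda (\<lambda>(a', b', c').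
     \<sigma> $ c $ c' * \<tau> $ (a, b) $ (a', b')))"

definition product_state :: "('a::finite \<times> 'b::finite \<times> 'c::finite) cmat \<Rightarrow> bool" where
  "product_state \<rho> \<longleftrightarrow>
     (\<exists>\<sigma> \<tau>. is_state \<sigma> \<and> is_state \<tau> \<and> \<rho> = tensor_A_BC \<sigma> \<tau>) \<or>
     (\<exists>\<sigma> \<tau>. is_state \<sigma> \<and> is_state \<tau> \<and> \<rho> = tensor_B_AC \<sigma> \<tau>) \<or>
     (\<exists>\<sigma> \<tau>. is_state \<sigma> \<and> is_state \<tau> \<and> \<rho> = tensor_C_AB \<sigma> \<tau>)"

definition biseparable :: "('a::finite \<times> 'b::finite \<times> 'c::finite) cmat \<Rightarrow> bool" where
  "biseparable \<rho> \<longleftrightarrow>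
     (\<exists>(n::nat) p \<omega>. (\<forall>k<n. 0 \<le> p k \<and> product_state (\<omega> k)) \<and> (\<Sum>k<n. p k) = 1 \<and>
        \<rho> = (\<Sum>k<n. p k *\<^sub>R \<omega> k))"

end

theory Submission
  imports Defs
begin

text \<open>By linearity it suffices to treat a product state \<open>\<sigma> \<otimes> \<tau>\<close>, where \<open>\<sigma>\<close> lives on one party. Then
  \<open>\<Phi>\<^sub>R[\<sigma> \<otimes> \<tau>] = R(\<sigma>) \<otimes> \<tau> + \<sigma> \<otimes> ((R \<otimes> I)(\<tau>) + (I \<otimes> R)(\<tau>) + (2/d) 1) + (1 - \<sigma>) \<otimes> (2/d) 1\<close>,
  and all three summands are positive semidefinite: the first because \<open>R\<close> is positive, the last
  because \<open>\<sigma> \<le> 1\<close>, and the middle one because \<open>(R \<otimes> I)(\<tau>) \<ge> -1/d\<close> for every bipartite state \<open>\<tau>\<close>.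
  A Cholesky decomposition reduces the claims about positive semidefinite matrices to rank one.\<close>

section \<open>Positive semidefinite matrices as sums of rank one matrices\<close>

definition outer :: "complex^'n \<Rightarrow> ('n::finite) cmat" where
  "outer w = (\<chi> i j. w $ i * cnj (w $ j))"

section \<open>The inner product and the quadratic forms of rank one and scalar matrices\<close>

lemma cinner_add_left: "cinner (u + v) w = cinner u w + cinner v w"
  by (simp add: cinner_def distrib_right sum.distrib)

lemma cinner_add_right: "cinner u (v + w) = cinner u v + cinner u w"
  by (simp add: cinner_def distrib_left sum.distrib)

lemma cinner_diff_right: "cinner u (v - w) = cinner u v - cinner u w"
  by (simp add: cinner_def right_diff_distrib sum_subtractf)

lemma cinner_scaleC_right: "cinner u (c *s v) = c * cinner u v"
  by (simp add: cinner_def sum_distrib_left mult_ac)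

lemma cinner_zero_right: "cinner u 0 = 0"
  by (simp add: cinner_def)

lemma cinner_commute: "cinner u v = cnj (cinner v u)"
  by (simp add: cinner_def mult.commute)

lemma cinner_axis: "cinner (axis k s) v = cnj s * v $ k"
  by (simp add: cinner_def axis_def if_distrib if_distribR cong: if_cong)

lemma cinner_self: "cinner v v = of_real ((norm v)\<^sup>2)"
  by (simp add: cinner_def norm_vec_def L2_set_def sum_nonneg complex_norm_square[symmetric] mult.commute)

lemma norm_cinner_le: "norm (cinner u v) \<le> norm u * norm v"
proof -
  have "norm (cinner u v) \<le> (\<Sum>i\<in>UNIV. norm (u $ i) * norm (v $ i))"
    unfolding cinner_def by (rule order_trans[OF norm_sum]) (simp add: norm_mult)
  also have "\<dots> \<le> norm u * norm v"
    using L2_set_mult_ineq[of "\<lambda>i. norm (u $ i)" "\<lambda>i. norm (v $ i)" UNIV]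
    by (simp add: norm_vec_def)
  finally show ?thesis .
qed

lemma hermitian_cinner:
  assumes "hermitian X"
  shows "cinner u (X *v v) = cinner (X *v u) v"
proof -
  have h: "cnj (X $ j $ i) = X $ i $ j" for i j
    by (metis assms hermitian_def)
  have "cinner (X *v u) v = (\<Sum>j\<in>UNIV. \<Sum>i\<in>UNIV. cnj (u $ i) * X $ i $ j * v $ j)"
    by (simp add: cinner_def matrix_vector_mult_def sum_distrib_left h mult_ac)
  also have "\<dots> = cinner u (X *v v)"
    by (subst sum.swap) (simp add: cinner_def matrix_vector_mult_def sum_distrib_left mult_ac)
  finally show ?thesis ..
qed

lemma matrix_vector_mult_axis: "X *v axis k s = s *s column k X" for X :: "('n::finite) cmat"
  by (simp add: vec_eq_iff matrix_vector_mult_def axis_def column_def if_distrib cong: if_cong)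

lemma outer_mult_vec: "outer w *v v = cinner w v *s w"
  by (simp add: vec_eq_iff outer_def matrix_vector_mult_def cinner_def sum_distrib_left mult_ac)

lemma cinner_outer: "cinner v (outer w *v v) = of_real ((norm (cinner w v))\<^sup>2)"
  by (simp add: outer_mult_vec cinner_scaleC_right complex_norm_square cinner_commute[of v w]
      del: of_real_power)

lemma trace_outer: "trace (outer w) = of_real ((norm w)\<^sup>2)"
  unfolding cinner_self[symmetric] by (simp add: trace_def outer_def cinner_def mult.commute)

lemma cinner_mat: "cinner v (mat c *v v) = c * of_real ((norm v)\<^sup>2)"
proof -
  have "mat c *v v = c *s v"
    by (simp add: vec_eq_iff matrix_vector_mult_def mat_def if_distrib if_distribR cong: if_cong)
  thus ?thesis by (simp add: cinner_scaleC_right cinner_self)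
qed

section \<open>Closure properties of positive semidefinite matrices\<close>

lemma psdI:
  assumes "\<And>i j. cnj (X $ j $ i) = X $ i $ j" and "\<And>v. 0 \<le> Re (cinner v (X *v v))"
  shows "psd X"
  unfolding psd_def hermitian_def by (metis assms)

lemma psd_cnj: "psd X \<Longrightarrow> cnj (X $ j $ i) = X $ i $ j"
  by (metis psd_def hermitian_def)

lemma psd_form: "psd X \<Longrightarrow> 0 \<le> Re (cinner v (X *v v))"
  by (simp add: psd_def)

lemma psd_outer: "psd (outer w)"
proof (rule psdI)
  show "0 \<le> Re (cinner v (outer w *v v))" for v
    unfolding cinner_outer by simp
qed (simp add: outer_def)

lemma psd_zero: "psd 0"
  by (rule psdI) (auto simp: cinner_zero_right)

lemma psd_add: "psd X \<Longrightarrow> psd Y \<Longrightarrow> psd (X + Y)"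
  by (rule psdI) (auto simp: psd_cnj psd_form matrix_vector_mult_add_rdistrib cinner_add_right)

lemma psd_scaleR: "0 \<le> c \<Longrightarrow> psd X \<Longrightarrow> psd (c *\<^sub>R X)"
proof -
  assume *: "0 \<le> c" "psd X"
  have "cinner v ((c *\<^sub>R X) *v v) = c *\<^sub>R cinner v (X *v v)" for v
    by (simp add: cinner_def matrix_vector_mult_def scaleR_sum_right sum_distrib_left)
  with * show ?thesis by (intro psdI) (auto simp: psd_cnj psd_form)
qed

lemma psd_sum: "(\<And>k. k \<in> K \<Longrightarrow> psd (X k)) \<Longrightarrow> psd (\<Sum>k\<in>K. X k)"
  by (induction K rule: infinite_finite_induct) (auto intro: psd_zero psd_add)

lemma psd_mat: "0 \<le> c \<Longrightarrow> psd (mat (complex_of_real c) :: ('n::finite) cmat)"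
proof -
  assume c: "0 \<le> c"
  show ?thesis
  proof (rule psdI)
    show "0 \<le> Re (cinner v (mat (complex_of_real c) *v v))" for v :: "complex^'n"
      unfolding cinner_mat using c by simp
  qed (simp add: mat_def)
qed

text \<open>The form of the reindexed matrix at \<open>v\<close> is the form of \<open>X\<close> at
  \<open>v\<close> composed with the inverse of \<open>f\<close>. This is what allows tensor factors
  to be permuted.\<close>

lemma psd_reindex:
  assumes "psd X" and "bij f"
  shows "psd (\<chi> i j. X $ f i $ f j)"
proof -
  let ?Y = "\<chi> i j. X $ f i $ f j"
  have s: "(\<Sum>i\<in>UNIV. F i) = (\<Sum>i\<in>UNIV. F (f i))" for F :: "_ \<Rightarrow> complex"
    using sum.reindex_bij_betw[OF assms(2), of F] by simp
  have "cinner v (?Y *v v) = cinner (\<chi> i. v $ inv f i) (X *v (\<chi> i. v $ inv f i))" for v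
  proof -
    define u where "u = (\<chi> i. v $ inv f i)"
    have u: "u $ f i = v $ i" for i using assms(2) by (simp add: u_def bij_is_inj)
    have "(X *v u) $ f i = (?Y *v v) $ i" for i
      using s[of "\<lambda>j. X $ f i $ j * u $ j"] by (simp add: u matrix_vector_mult_def)
    thus ?thesis
      using s[of "\<lambda>i. cnj (u $ i) * (X *v u) $ i"] by (simp add: u cinner_def flip: u_def)
  qed
  with assms(1) show ?thesis by (intro psdI) (auto simp: psd_cnj psd_form)
qed

section \<open>Cholesky decomposition as an induction principle\<close>

lemma psd_diag:
  assumes "psd X"
  shows "X $ k $ k = of_real (Re (X $ k $ k))" and "0 \<le> Re (X $ k $ k)"
proof -
  have "X $ k $ k = cnj (X $ k $ k)"
    using psd_cnj[OF assms, of k k] by simp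
  thus "X $ k $ k = of_real (Re (X $ k $ k))"
    by (simp add: complex_eq_iff)
  have "0 \<le> Re (cinner (axis k 1) (X *v axis k 1))"
    using psd_form[OF assms] .
  thus "0 \<le> Re (X $ k $ k)"
    by (simp add: cinner_axis matrix_vector_mult_axis column_def)
qed

text \<open>Since \<open>X\<close> is Hermitian, the two cross terms are conjugate to each other and
  add up to twice a real part. The expansion serves to test positivity along a coordinate
  direction.\<close>

lemma psd_form_perturb:
  assumes "psd X"
  shows "Re (cinner (v + axis k s) (X *v (v + axis k s))) =
    Re (cinner v (X *v v)) + 2 * Re (cnj s * (X *v v) $ k) + (norm s)\<^sup>2 * Re (X $ k $ k)"
proof -
  have h: "hermitian X" using assms by (simp add: psd_def)
  have 1: "cinner v (X *v axis k s) = cnj (cnj s * (X *v v) $ k)"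
    by (metis cinner_axis cinner_commute h hermitian_cinner)
  have 2: "cinner (axis k s) (X *v axis k s) = of_real ((norm s)\<^sup>2) * X $ k $ k"
    by (simp add: cinner_axis matrix_vector_mult_axis column_def complex_norm_square del: of_real_power)
  have "cinner (v + axis k s) (X *v (v + axis k s)) = cinner v (X *v v) + cnj (cnj s * (X *v v) $ k) +
      (cnj s * (X *v v) $ k + of_real ((norm s)\<^sup>2) * X $ k $ k)"
    by (simp only: matrix_vector_right_distrib cinner_add_left cinner_add_right 1 2
        cinner_axis[of k s "X *v v"]) (simp add: algebra_simps)
  thus ?thesis by (simp del: of_real_power)
qed

text \<open>With a vanishing diagonal entry the form at \<open>axis l 1\<close> plus a multiple of
  \<open>axis k 1\<close> is affine in that multiple, so a nonzero \<open>X $ k $ l\<close> would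
  make it negative somewhere.\<close>

lemma psd_diag_zero:
  assumes "psd X" and "X $ k $ k = 0"
  shows "X $ k $ l = 0"
proof (rule ccontr)
  assume "X $ k $ l \<noteq> 0"
  define n where "n = (norm (X $ k $ l))\<^sup>2"
  have n: "n > 0" using \<open>X $ k $ l \<noteq> 0\<close> by (simp add: n_def)
  \<comment> \<open>Chosen so that \<open>2 * t * n\<close> exceeds the diagonal entry at
    \<open>l\<close> by one; the form then takes the value -1.\<close>
  define t where "t = (Re (X $ l $ l) + 1) / (2 * n)"
  have "0 \<le> Re (cinner (axis l 1 + axis k (- of_real t * X $ k $ l))
      (X *v (axis l 1 + axis k (- of_real t * X $ k $ l))))"
    using psd_form[OF assms(1)] .
  also have "\<dots> = Re (X $ l $ l) - 2 * t * n"
  proof -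
    have "Re (cnj (X $ k $ l) * X $ k $ l) = n"
      by (metis n_def Re_complex_of_real complex_norm_square mult.commute)
    thus ?thesis
      unfolding psd_form_perturb[OF assms(1)] assms(2)
      by (simp add: cinner_axis matrix_vector_mult_axis column_def algebra_simps)
  qed
  also have "2 * t * n = Re (X $ l $ l) + 1" using n by (simp add: t_def)
  finally show False by simp
qed

text \<open>One Cholesky step: subtracting \<open>outer w\<close>, for \<open>w\<close> the scaled \<open>k\<close>-th column, amounts to
  minimising the quadratic form along \<open>e\<^sub>k\<close>.\<close>

lemma psd_cholesky_step:
  assumes "psd X" and "X $ k $ k \<noteq> 0"
  obtains w where "psd (X - outer w)" "(X - outer w) $ k = 0"
    "\<And>i. X $ i = 0 \<Longrightarrow> (X - outer w) $ i = 0"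
proof -
  define r where "r = Re (X $ k $ k)"
  have rX: "X $ k $ k = of_real r" and r: "r > 0"
    using psd_diag[OF assms(1), of k] assms(2) by (auto simp: r_def less_le)
  have h: "cnj (X $ j $ i) = X $ i $ j" for i j
    using psd_cnj[OF assms(1)] .
  \<comment> \<open>With the divisor \<open>sqrt r\<close>, \<open>outer w\<close> agrees with
    \<open>X\<close> on the whole row and column \<open>k\<close>, so the difference vanishes
    there.\<close>
  define w where "w = (\<chi> i. X $ i $ k / of_real (sqrt r))"
  have ww: "outer w $ i $ j = X $ i $ k * X $ k $ j / of_real r" for i j
    using r by (simp add: outer_def w_def h flip: of_real_mult)
  have wv: "(norm (cinner w v))\<^sup>2 = (norm ((X *v v) $ k))\<^sup>2 / r" for v
  proof -
    have "cinner w v = (X *v v) $ k / of_real (sqrt r)"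
      by (simp add: cinner_def w_def h matrix_vector_mult_def sum_divide_distrib)
    thus ?thesis using r by (simp add: norm_divide power_divide)
  qed
  have "0 \<le> Re (cinner v ((X - outer w) *v v))" for v
  proof -
    define z where "z = (X *v v) $ k"
    \<comment> \<open>The minimiser of \<open>2 * Re (cnj s * z) + (norm s)\<^sup>2 * r\<close>; the
      minimum is minus the squared norm of \<open>z\<close> over \<open>r\<close>, which is exactly
      what subtracting \<open>outer w\<close> contributes at \<open>v\<close>.\<close>
    define s where "s = - z / of_real r"
    have zz: "cnj z * z = of_real ((norm z)\<^sup>2)"
      by (metis complex_norm_square mult.commute)
    have "0 \<le> Re (cinner (v + axis k s) (X *v (v + axis k s)))"
      using psd_form[OF assms(1)] .
    also have "\<dots> = Re (cinner v (X *v v)) + 2 * Re (cnj s * z) + (norm s)\<^sup>2 * r"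
      unfolding psd_form_perturb[OF assms(1)] z_def r_def ..
    also have "cnj s * z = of_real (- (norm z)\<^sup>2 / r)"
      using zz by (simp add: s_def del: of_real_power)
    also have "(norm s)\<^sup>2 * r = (norm z)\<^sup>2 / r"
      using r by (simp add: s_def norm_divide power2_eq_square)
    also have "Re (cinner v (X *v v)) + 2 * Re (of_real (- (norm z)\<^sup>2 / r)) + (norm z)\<^sup>2 / r =
        Re (cinner v ((X - outer w) *v v))"
      by (simp add: matrix_vector_mult_diff_rdistrib cinner_diff_right cinner_outer wv z_def
          del: of_real_power)
    finally show ?thesis .
  qed
  hence "psd (X - outer w)"
    by (rule psdI[rotated]) (simp add: ww h mult.commute)
  moreover have "(X - outer w) $ k = 0"
    using r by (simp add: vec_eq_iff ww rX)
  moreover have "(X - outer w) $ i = 0" if "X $ i = 0" for i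
    using that by (simp add: vec_eq_iff ww)
  ultimately show thesis by (rule that)
qed

text \<open>A Cholesky step clears row \<open>k\<close> and leaves zero rows zero, so the number of
  nonzero rows drops. Once the diagonal vanishes, so does the matrix. Claims additive in
  \<open>X\<close> thereby reduce to rank one.\<close>

lemma psd_induct [consumes 1, case_names zero outer add]:
  assumes "psd X"
    and zero: "P 0"
    and outer: "\<And>w. P (outer w)"
    and add: "\<And>X Y. P X \<Longrightarrow> P Y \<Longrightarrow> P (X + Y)"
  shows "P X"
  using assms(1)
proof (induction "card {i. X $ i \<noteq> 0}" arbitrary: X rule: less_induct)
  case less
  show ?case
  proof (cases "\<forall>k. X $ k $ k = 0")
    case True
    hence "X = 0" using psd_diag_zero[OF less.prems] by (simp add: vec_eq_iff)
    thus ?thesis using zero by simp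
  next
    case False
    then obtain k where k: "X $ k $ k \<noteq> 0" by blast
    then obtain w where w: "psd (X - outer w)" "(X - outer w) $ k = 0"
      "\<And>i. X $ i = 0 \<Longrightarrow> (X - outer w) $ i = 0"
      using psd_cholesky_step[OF less.prems k] by blast
    have "X $ k \<noteq> 0" using k by auto
    have "{i. (X - outer w) $ i \<noteq> 0} \<subset> {i. X $ i \<noteq> 0}"
    proof
      show "{i. (X - outer w) $ i \<noteq> 0} \<subseteq> {i. X $ i \<noteq> 0}" using w(3) by blast
      show "{i. (X - outer w) $ i \<noteq> 0} \<noteq> {i. X $ i \<noteq> 0}"
        using w(2) \<open>X $ k \<noteq> 0\<close> by blast
    qed
    hence "card {i. (X - outer w) $ i \<noteq> 0} < card {i. X $ i \<noteq> 0}"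
      by (simp add: psubset_card_mono)
    hence "P (X - outer w)" using less.hyps w(1) by blast
    from add[OF this outer[of w]] show ?thesis by simp
  qed
qed

section \<open>Tensor products and reductions\<close>

definition kron :: "('a::finite) cmat \<Rightarrow> ('b::finite) cmat \<Rightarrow> ('a \<times> 'b) cmat" where
  "kron X Y = (\<chi> i j. X $ fst i $ fst j * Y $ snd i $ snd j)"

text \<open>By bilinearity, induction on both factors leaves only two rank one matrices, whose
  product is the rank one matrix of the tensor product of their vectors.\<close>

lemma psd_kron:
  fixes X :: "('a::finite) cmat" and Y :: "('b::finite) cmat"
  assumes "psd X" and "psd Y"
  shows "psd (kron X Y)"
  using assms(1)
proof (induction rule: psd_induct)
  case zero
  have "kron (0 :: 'a cmat) Y = 0" by (simp add: kron_def vec_eq_iff)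
  thus ?case by (simp add: psd_zero)
next
  case (add X1 X2)
  have "kron (X1 + X2) Y = kron X1 Y + kron X2 Y"
    by (simp add: kron_def vec_eq_iff distrib_right)
  thus ?case using add by (simp add: psd_add)
next
  case (outer v)
  show ?case using assms(2)
  proof (induction rule: psd_induct)
    case zero
    have "kron (outer v) (0 :: 'b cmat) = 0" by (simp add: kron_def vec_eq_iff)
    thus ?case by (simp add: psd_zero)
  next
    case (add Y1 Y2)
    have "kron (outer v) (Y1 + Y2) = kron (outer v) Y1 + kron (outer v) Y2"
      by (simp add: kron_def vec_eq_iff distrib_left)
    thus ?case using add by (simp add: psd_add)
  next
    case (outer w)
    have "kron (outer v) (outer w) = outer (\<chi> i. v $ fst i * w $ snd i)"
      by (simp add: kron_def outer_def vec_eq_iff)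
    thus ?case by (simp add: psd_outer)
  qed
qed

lemma psd_tensor_A_BC: "psd \<sigma> \<Longrightarrow> psd \<tau> \<Longrightarrow> psd (tensor_A_BC \<sigma> \<tau>)"
proof -
  assume "psd \<sigma>" "psd \<tau>"
  moreover have "tensor_A_BC \<sigma> \<tau> = kron \<sigma> \<tau>"
    by (auto simp: vec_eq_iff tensor_A_BC_def kron_def)
  ultimately show ?thesis by (simp add: psd_kron)
qed

text \<open>Moving the party \<open>B\<close> to the front of the index triples turns this product
  into \<open>kron\<close>.\<close>

lemma psd_tensor_B_AC: "psd \<sigma> \<Longrightarrow> psd \<tau> \<Longrightarrow> psd (tensor_B_AC \<sigma> \<tau>)"
proof -
  assume "psd \<sigma>" "psd \<tau>"
  moreover have "bij (\<lambda>(a, b, c). (b, a, c))"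
    by (rule bij_betwI[where g = "\<lambda>(b, a, c). (a, b, c)"]) auto
  ultimately have "psd (\<chi> i j. kron \<sigma> \<tau> $ (case i of (a, b, c) \<Rightarrow> (b, a, c)) $
      (case j of (a, b, c) \<Rightarrow> (b, a, c)))"
    by (intro psd_reindex psd_kron)
  moreover have "tensor_B_AC \<sigma> \<tau> = (\<chi> i j. kron \<sigma> \<tau> $ (case i of (a, b, c) \<Rightarrow> (b, a, c)) $
      (case j of (a, b, c) \<Rightarrow> (b, a, c)))"
    by (auto simp: vec_eq_iff tensor_B_AC_def kron_def)
  ultimately show ?thesis by simp
qed

lemma psd_tensor_C_AB: "psd \<sigma> \<Longrightarrow> psd \<tau> \<Longrightarrow> psd (tensor_C_AB \<sigma> \<tau>)"
proof -
  assume "psd \<sigma>" "psd \<tau>"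
  moreover have "bij (\<lambda>(a, b, c). (c, a, b))"
    by (rule bij_betwI[where g = "\<lambda>(c, a, b). (a, b, c)"]) auto
  ultimately have "psd (\<chi> i j. kron \<sigma> \<tau> $ (case i of (a, b, c) \<Rightarrow> (c, a, b)) $
      (case j of (a, b, c) \<Rightarrow> (c, a, b)))"
    by (intro psd_reindex psd_kron)
  moreover have "tensor_C_AB \<sigma> \<tau> = (\<chi> i j. kron \<sigma> \<tau> $ (case i of (a, b, c) \<Rightarrow> (c, a, b)) $
      (case j of (a, b, c) \<Rightarrow> (c, a, b)))"
    by (auto simp: vec_eq_iff tensor_C_AB_def kron_def)
  ultimately show ?thesis by simp
qed

section \<open>The reduction map on one party and on half of a bipartite state\<close>

text \<open>For rank one this is the Cauchy-Schwarz inequality. It yields both the positivity of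
  \<open>R_map\<close> and the bound of a state by the identity.\<close>

lemma psd_trace_minus:
  fixes X :: "('n::finite) cmat"
  assumes "psd X"
  shows "psd (mat (trace X) - X)"
  using assms
proof (induction rule: psd_induct)
  case zero
  have "mat (trace (0 :: 'n cmat)) - 0 = (0 :: 'n cmat)"
    by (simp add: vec_eq_iff mat_def trace_def)
  thus ?case by (simp only: psd_zero)
next
  case (add X Y)
  have "mat (trace (X + Y)) - (X + Y) = (mat (trace X) - X) + (mat (trace Y) - Y)"
    by (simp add: vec_eq_iff mat_def trace_add)
  thus ?case using psd_add[OF add] by (simp only:)
next
  case (outer w)
  have "(norm (cinner w v))\<^sup>2 \<le> (norm w)\<^sup>2 * (norm v)\<^sup>2" for v
    using power_mono[OF norm_cinner_le[of w v]] by (simp add: power_mult_distrib)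
  hence "0 \<le> Re (cinner v ((mat (trace (outer w)) - outer w) *v v))" for v
    by (simp add: matrix_vector_mult_diff_rdistrib cinner_diff_right cinner_outer cinner_mat
        trace_outer del: of_real_power flip: of_real_mult)
  moreover have "cnj ((mat (trace (outer w)) - outer w) $ j $ i) =
      (mat (trace (outer w)) - outer w) $ i $ j" for i j
    unfolding trace_outer by (simp add: mat_def outer_def)
  ultimately show ?case by (intro psdI)
qed

lemma psd_R_map:
  fixes X :: "('d::finite) cmat"
  assumes "psd X"
  shows "psd (R_map X)"
proof -
  have "0 < CARD('d)" by (simp add: card_gt_0_iff)
  \<comment> \<open>In dimension one the prefactor of \<open>R_map\<close> is 1/0 = 0, so it is
    nonnegative there as well.\<close>
  hence "1 \<le> real CARD('d)" by linarith
  thus ?thesis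
    unfolding R_map_def by (intro psd_scaleR psd_trace_minus assms) simp
qed

text \<open>Two-party counterparts of \<open>on_A\<close>, \<open>on_B\<close> and
  \<open>on_C\<close>: a map on a party that shares \<open>\<tau>\<close> acts on one factor of
  \<open>\<tau>\<close> only.\<close>

definition on_fst ::
  "('a cmat \<Rightarrow> 'a cmat) \<Rightarrow> ('a::finite \<times> 'b::finite) cmat \<Rightarrow> ('a \<times> 'b) cmat" where
  "on_fst L X = (\<chi> k l. L (\<chi> i j. X $ (i, snd k) $ (j, snd l)) $ fst k $ fst l)"

definition on_snd ::
  "('b cmat \<Rightarrow> 'b cmat) \<Rightarrow> ('a::finite \<times> 'b::finite) cmat \<Rightarrow> ('a \<times> 'b) cmat" where
  "on_snd L X = (\<chi> k l. L (\<chi> i j. X $ (fst k, i) $ (fst l, j)) $ snd k $ snd l)"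

text \<open>The matrix \<open>1 \<otimes> Tr\<^sub>1 X\<close>.\<close>

definition id_ptrace :: "('a::finite \<times> 'b::finite) cmat \<Rightarrow> ('a \<times> 'b) cmat" where
  "id_ptrace X = (\<chi> k l. if fst k = fst l then \<Sum>i\<in>UNIV. X $ (i, snd k) $ (i, snd l) else 0)"

text \<open>The idea for \<open>X = outer w\<close> is to write \<open>\<bar>\<langle>w,v\<rangle>\<bar>\<^sup>2\<close> as the convex combination with weights
  \<open>1/d\<close> and \<open>1 - 1/d\<close> of itself with itself. In the first copy, \<open>\<langle>w,v\<rangle>\<close> is a sum of \<open>d\<close> terms, one
  for each basis vector of the first factor, so Cauchy-Schwarz costs only a factor \<open>d\<close>; in the
  second copy Cauchy-Schwarz gives \<open>\<parallel>w\<parallel>\<^sup>2 \<parallel>v\<parallel>\<^sup>2\<close>.\<close>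

lemma psd_id_ptrace_minus:
  fixes X :: "('a::finite \<times> 'b::finite) cmat"
  assumes "psd X"
  shows "psd (id_ptrace X - X + (1 - 1 / real CARD('a)) *\<^sub>R mat (trace X))"
  using assms
proof (induction rule: psd_induct)
  case zero
  have "id_ptrace 0 - 0 + (1 - 1 / real CARD('a)) *\<^sub>R mat (trace (0 :: ('a \<times> 'b) cmat)) =
      (0 :: ('a \<times> 'b) cmat)"
    by (simp add: vec_eq_iff mat_def trace_def id_ptrace_def)
  thus ?case by (simp only: psd_zero)
next
  case (add X Y)
  have "id_ptrace (X + Y) - (X + Y) + (1 - 1 / real CARD('a)) *\<^sub>R mat (trace (X + Y)) =
    (id_ptrace X - X + (1 - 1 / real CARD('a)) *\<^sub>R mat (trace X)) +
    (id_ptrace Y - Y + (1 - 1 / real CARD('a)) *\<^sub>R mat (trace Y))"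
    by (simp add: vec_eq_iff mat_def trace_add id_ptrace_def sum.distrib algebra_simps)
  thus ?case using psd_add[OF add] by (simp only:)
next
  case (outer w)
  define d where "d = real CARD('a)"
  have "0 < CARD('a)" by (simp add: card_gt_0_iff)
  hence d: "d \<ge> 1" unfolding d_def by linarith
  \<comment> \<open>The tensor product of the basis vector at \<open>b\<close> with the block of
    \<open>w\<close> at \<open>a\<close>. All these vectors together decompose
    \<open>id_ptrace (outer w)\<close>, while those with \<open>a = b\<close> sum to
    \<open>w\<close>.\<close>
  define u where "u a b = (\<chi> k :: 'a \<times> 'b. if fst k = b then w $ (a, snd k) else 0)" for a b
  have pt: "id_ptrace (outer w) = (\<Sum>a\<in>UNIV. \<Sum>b\<in>UNIV. outer (u a b))"
  proof -
    have "(\<Sum>a\<in>UNIV. \<Sum>b\<in>UNIV. outer (u a b)) $ k $ l = (\<Sum>a\<in>UNIV. \<Sum>b\<in>UNIV.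
        if fst k = b then (if fst k = fst l then w $ (a, snd k) * cnj (w $ (a, snd l)) else 0) else 0)"
      for k l
      unfolding sum_component by (intro sum.cong refl) (simp add: outer_def u_def)
    thus ?thesis by (simp add: vec_eq_iff id_ptrace_def) (simp add: outer_def)
  qed
  have w: "w = (\<Sum>a\<in>UNIV. u a a)"
    by (auto simp: vec_eq_iff u_def)
  have form_pt: "cinner v (id_ptrace (outer w) *v v) =
      of_real (\<Sum>a\<in>UNIV. \<Sum>b\<in>UNIV. (norm (cinner (u a b) v))\<^sup>2)" for v
  proof -
    have s: "cinner v (sum F A *v v) = (\<Sum>a\<in>A. cinner v (F a *v v))"
      for F :: "'a \<Rightarrow> ('a \<times> 'b) cmat" and A
      by (induction A rule: infinite_finite_induct)
        (auto simp: cinner_zero_right matrix_vector_mult_add_rdistrib cinner_add_right)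
    show ?thesis unfolding pt s cinner_outer by simp
  qed
  have key: "(norm (cinner w v))\<^sup>2 \<le>
      (\<Sum>a\<in>UNIV. \<Sum>b\<in>UNIV. (norm (cinner (u a b) v))\<^sup>2) + (1 - 1 / d) * ((norm w)\<^sup>2 * (norm v)\<^sup>2)" for v
  proof -
    have wu: "cinner w v = (\<Sum>a\<in>UNIV. cinner (u a a) v)"
    proof -
      have "cinner (sum F A) v = (\<Sum>a\<in>A. cinner (F a) v)" for F :: "'a \<Rightarrow> complex^('a \<times> 'b)" and A
        by (induction A rule: infinite_finite_induct)
          (auto simp: cinner_def distrib_right sum.distrib)
      thus ?thesis by (subst w) simp
    qed
    have "norm (cinner w v) \<le> (\<Sum>a\<in>UNIV. 1 * norm (cinner (u a a) v))"
      unfolding wu using norm_sum by simp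
    hence "(norm (cinner w v))\<^sup>2 \<le> (\<Sum>a\<in>UNIV. 1 * norm (cinner (u a a) v))\<^sup>2"
      by (simp add: power_mono)
    also have "\<dots> \<le> (\<Sum>a\<in>(UNIV :: 'a set). 1\<^sup>2) * (\<Sum>a\<in>UNIV. (norm (cinner (u a a) v))\<^sup>2)"
      by (rule Cauchy_Schwarz_ineq_sum)
    also have "\<dots> = d * (\<Sum>a\<in>UNIV. (norm (cinner (u a a) v))\<^sup>2)"
      by (simp add: d_def)
    \<comment> \<open>Only the diagonal vectors \<open>u a a\<close> enter
      \<open>cinner w v\<close>; the remaining squares are nonnegative and complete the form of
      \<open>id_ptrace (outer w)\<close>.\<close>
    also have "\<dots> \<le> d * (\<Sum>a\<in>UNIV. \<Sum>b\<in>UNIV. (norm (cinner (u a b) v))\<^sup>2)"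
      using d by (intro mult_left_mono sum_mono member_le_sum) auto
    finally have 1: "(norm (cinner w v))\<^sup>2 / d \<le> (\<Sum>a\<in>UNIV. \<Sum>b\<in>UNIV. (norm (cinner (u a b) v))\<^sup>2)"
      using d by (simp add: field_simps)
    have "(norm (cinner w v))\<^sup>2 \<le> (norm w)\<^sup>2 * (norm v)\<^sup>2"
      using power_mono[OF norm_cinner_le[of w v]] by (simp add: power_mult_distrib)
    hence 2: "(1 - 1 / d) * (norm (cinner w v))\<^sup>2 \<le> (1 - 1 / d) * ((norm w)\<^sup>2 * (norm v)\<^sup>2)"
      using d by (intro mult_left_mono) auto
    have "(norm (cinner w v))\<^sup>2 = (norm (cinner w v))\<^sup>2 / d + (1 - 1 / d) * (norm (cinner w v))\<^sup>2"
      by (simp add: algebra_simps)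
    with 1 2 show ?thesis by linarith
  qed
  have m: "(1 - 1 / d) *\<^sub>R mat (trace (outer w)) =
      (mat (of_real ((1 - 1 / d) * (norm w)\<^sup>2)) :: ('a \<times> 'b) cmat)"
    unfolding trace_outer by (simp add: vec_eq_iff mat_def scaleR_conv_of_real[where 'a = complex])
  have "0 \<le> Re (cinner v ((id_ptrace (outer w) - outer w +
      (1 - 1 / d) *\<^sub>R mat (trace (outer w))) *v v))" for v
    unfolding m using key[of v]
    by (simp add: matrix_vector_mult_diff_rdistrib matrix_vector_mult_add_rdistrib
        cinner_diff_right cinner_add_right cinner_outer cinner_mat form_pt mult.assoc
        del: of_real_power of_real_sum of_real_mult flip: of_real_mult)
  moreover have "cnj ((id_ptrace (outer w) - outer w + (1 - 1 / d) *\<^sub>R mat (trace (outer w))) $ j $ i) =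
      (id_ptrace (outer w) - outer w + (1 - 1 / d) *\<^sub>R mat (trace (outer w))) $ i $ j" for i j
    unfolding m by (auto simp: id_ptrace_def outer_def mat_def mult.commute)
  ultimately show ?case
    unfolding d_def by (intro psdI)
qed

text \<open>Divide the bound for \<open>id_ptrace\<close> by d - 1: the trace is one and 1 - 1/d
  equals (d - 1)/d, so the identity is left with the coefficient 1/d.\<close>

lemma psd_on_fst_R_map:
  fixes \<tau> :: "('d::finite \<times> 'b::finite) cmat"
  assumes "CARD('d) \<ge> 2" and "is_state \<tau>"
  shows "psd (on_fst R_map \<tau> + (1 / real CARD('d)) *\<^sub>R mat 1)"
proof -
  define d where "d = real CARD('d)"
  have d: "d \<ge> 2" using assms(1) by (simp add: d_def)
  have "psd ((1 / (d - 1)) *\<^sub>R (id_ptrace \<tau> - \<tau> + (1 - 1 / d) *\<^sub>R mat (trace \<tau>)))"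
    using assms d psd_id_ptrace_minus[of \<tau>] by (intro psd_scaleR) (auto simp: is_state_def d_def)
  moreover have "on_fst R_map \<tau> + (1 / d) *\<^sub>R mat 1 =
      (1 / (d - 1)) *\<^sub>R (id_ptrace \<tau> - \<tau> + (1 - 1 / d) *\<^sub>R mat (trace \<tau>))"
  proof -
    have "(1 / (d - 1)) * (1 - 1 / d) = 1 / d" using d by (simp add: field_simps)
    thus ?thesis
      using assms(2)
      by (auto simp: vec_eq_iff is_state_def on_fst_def R_map_def id_ptrace_def mat_def trace_def
          scaleR_add_right d_def)
  qed
  ultimately show ?thesis by (simp add: d_def)
qed

text \<open>Swapping the two factors preserves states and exchanges \<open>on_snd\<close> with
  \<open>on_fst\<close>.\<close>

lemma psd_on_snd_R_map:
  fixes \<tau> :: "('b::finite \<times> 'd::finite) cmat"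
  assumes "CARD('d) \<ge> 2" and "is_state \<tau>"
  shows "psd (on_snd R_map \<tau> + (1 / real CARD('d)) *\<^sub>R mat 1)"
proof -
  define \<tau>' where "\<tau>' = (\<chi> i j. \<tau> $ prod.swap i $ prod.swap j)"
  have "trace \<tau>' = trace \<tau>"
    unfolding trace_def \<tau>'_def by (simp add: sum.reindex_bij_betw[OF bij_swap, of "\<lambda>i. \<tau> $ i $ i"])
  hence "is_state \<tau>'"
    using assms(2) psd_reindex[OF _ bij_swap, of \<tau>] by (simp add: is_state_def \<tau>'_def)
  from psd_reindex[OF psd_on_fst_R_map[OF assms(1) this] bij_swap]
  show ?thesis
    by (rule back_subst[where P = psd])
      (auto simp: vec_eq_iff on_fst_def on_snd_def \<tau>'_def mat_def)
qed

section \<open>The map on biseparable states\<close>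

lemma sum_UNIV_prod:
  "(\<Sum>x\<in>UNIV. f x) = (\<Sum>a\<in>UNIV. \<Sum>b\<in>UNIV. f (a :: 'a::finite, b :: 'b::finite))"
  by (simp add: sum.cartesian_product)

lemma trace_tensor_A_BC: "trace (tensor_A_BC \<sigma> \<tau>) = trace \<sigma> * trace \<tau>"
  unfolding trace_def sum_product by (simp add: tensor_A_BC_def sum_UNIV_prod sum_distrib_left)

lemma trace_tensor_B_AC: "trace (tensor_B_AC \<sigma> \<tau>) = trace \<sigma> * trace \<tau>"
  unfolding trace_def sum_product by (simp add: tensor_B_AC_def sum_UNIV_prod sum_distrib_left)
    (rule sum.swap)

lemma trace_tensor_C_AB: "trace (tensor_C_AB \<sigma> \<tau>) = trace \<sigma> * trace \<tau>"
  by (simp add: trace_def tensor_C_AB_def sum_UNIV_prod sum_distrib_left sum_distrib_right mult_ac)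

text \<open>Homogeneity in entrywise form: a block of \<open>\<sigma>\<close> tensor
  \<open>\<tau>\<close> in one party is a fixed entry of one factor times a block of the other. Here
  the fixed entry comes from \<open>\<sigma>\<close>, in the next lemma from
  \<open>\<tau>\<close>.\<close>

lemma R_map_mult_left:
  "R_map (\<chi> i j. x * F i j) $ k $ l = x * R_map (\<chi> i j. F i j) $ k $ l"
  by (simp add: R_map_def mat_def trace_def right_diff_distrib flip: sum_distrib_left)

lemma R_map_mult_right: "R_map (\<chi> i j. X $ i $ j * x) $ k $ l = R_map X $ k $ l * x"
  by (simp add: R_map_def mat_def trace_def left_diff_distrib flip: sum_distrib_right)

lemma psd_Phi_R_product_state:
  fixes \<rho> :: "('d::finite \<times> 'd \<times> 'd) cmat"
  assumes "CARD('d) \<ge> 2" and "product_state \<rho>"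
  shows "psd (Phi_R (2 / real CARD('d)) \<rho>)"
proof -
  define c where "c = 1 / real CARD('d)"
  \<comment> \<open>The constant 2/d is shared equally between the two maps acting on
    \<open>\<tau>\<close>, each of which needs 1/d.\<close>
  define N where "N \<tau> = (on_fst R_map \<tau> + c *\<^sub>R mat 1) + (on_snd R_map \<tau> + c *\<^sub>R mat 1)"
    for \<tau> :: "('d \<times> 'd) cmat"
  have N: "psd (N \<tau>)" if "is_state \<tau>" for \<tau>
    unfolding N_def c_def using that assms(1)
    by (intro psd_add psd_on_fst_R_map psd_on_snd_R_map)
  have c: "psd ((2 * c) *\<^sub>R mat 1 :: ('d \<times> 'd) cmat)"
    using psd_scaleR[of "2 * c" "mat 1"] psd_mat[of 1] by (simp add: c_def)
  have m: "psd (mat 1 - \<sigma>)" if "is_state \<sigma>" for \<sigma> :: "'d cmat"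
    using psd_trace_minus[of \<sigma>] that by (simp add: is_state_def)
  from assms(2) consider
      (A) \<sigma> \<tau> where "is_state \<sigma>" "is_state \<tau>" "\<rho> = tensor_A_BC \<sigma> \<tau>"
    | (B) \<sigma> \<tau> where "is_state \<sigma>" "is_state \<tau>" "\<rho> = tensor_B_AC \<sigma> \<tau>"
    | (C) \<sigma> \<tau> where "is_state \<sigma>" "is_state \<tau>" "\<rho> = tensor_C_AB \<sigma> \<tau>"
    unfolding product_state_def by blast
  thus ?thesis
  proof cases
    case A
    have L: "on_A R_map \<rho> = tensor_A_BC (R_map \<sigma>) \<tau>"
      "on_B R_map \<rho> = tensor_A_BC \<sigma> (on_fst R_map \<tau>)"
      "on_C R_map \<rho> = tensor_A_BC \<sigma> (on_snd R_map \<tau>)"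
      using A(3) by (simp_all add: vec_eq_iff on_A_def on_B_def on_C_def on_fst_def on_snd_def
          tensor_A_BC_def R_map_mult_left R_map_mult_right)
    have t: "trace \<rho> = 1"
      using A by (simp add: trace_tensor_A_BC is_state_def)
    \<comment> \<open>The identity on three parties splits as \<open>\<sigma>\<close> tensor 1 plus
      \<open>mat 1 - \<sigma>\<close> tensor 1; the first part is absorbed into
      \<open>N \<tau>\<close>.\<close>
    have "Phi_R (2 * c) \<rho> = tensor_A_BC (R_map \<sigma>) \<tau> + tensor_A_BC \<sigma> (N \<tau>) +
        tensor_A_BC (mat 1 - \<sigma>) ((2 * c) *\<^sub>R mat 1)"
      unfolding Phi_R_def L t
      by (simp add: vec_eq_iff tensor_A_BC_def N_def mat_def algebra_simps
          scaleR_conv_of_real[where 'a = complex])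
    moreover have "psd \<dots>"
      using A N m c by (intro psd_add psd_tensor_A_BC psd_R_map) (auto simp: is_state_def)
    ultimately show ?thesis by (simp add: c_def)
  next
    case B
    \<comment> \<open>The other parties keep their order in \<open>\<tau>\<close>: here
      \<open>A\<close> is its first factor and \<open>C\<close> its second.\<close>
    have L: "on_A R_map \<rho> = tensor_B_AC \<sigma> (on_fst R_map \<tau>)"
      "on_B R_map \<rho> = tensor_B_AC (R_map \<sigma>) \<tau>"
      "on_C R_map \<rho> = tensor_B_AC \<sigma> (on_snd R_map \<tau>)"
      using B(3) by (simp_all add: vec_eq_iff on_A_def on_B_def on_C_def on_fst_def on_snd_def
          tensor_B_AC_def R_map_mult_left R_map_mult_right)
    have t: "trace \<rho> = 1"
      using B by (simp add: trace_tensor_B_AC is_state_def)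
    have "Phi_R (2 * c) \<rho> = tensor_B_AC (R_map \<sigma>) \<tau> + tensor_B_AC \<sigma> (N \<tau>) +
        tensor_B_AC (mat 1 - \<sigma>) ((2 * c) *\<^sub>R mat 1)"
      unfolding Phi_R_def L t
      by (simp add: vec_eq_iff tensor_B_AC_def N_def mat_def algebra_simps
          scaleR_conv_of_real[where 'a = complex])
    moreover have "psd \<dots>"
      using B N m c by (intro psd_add psd_tensor_B_AC psd_R_map) (auto simp: is_state_def)
    ultimately show ?thesis by (simp add: c_def)
  next
    case C
    have L: "on_A R_map \<rho> = tensor_C_AB \<sigma> (on_fst R_map \<tau>)"
      "on_B R_map \<rho> = tensor_C_AB \<sigma> (on_snd R_map \<tau>)"
      "on_C R_map \<rho> = tensor_C_AB (R_map \<sigma>) \<tau>"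
      using C(3) by (simp_all add: vec_eq_iff on_A_def on_B_def on_C_def on_fst_def on_snd_def
          tensor_C_AB_def R_map_mult_left R_map_mult_right)
    have t: "trace \<rho> = 1"
      using C by (simp add: trace_tensor_C_AB is_state_def)
    have "Phi_R (2 * c) \<rho> = tensor_C_AB (R_map \<sigma>) \<tau> + tensor_C_AB \<sigma> (N \<tau>) +
        tensor_C_AB (mat 1 - \<sigma>) ((2 * c) *\<^sub>R mat 1)"
      unfolding Phi_R_def L t
      by (simp add: vec_eq_iff tensor_C_AB_def N_def mat_def algebra_simps
          scaleR_conv_of_real[where 'a = complex])
    moreover have "psd \<dots>"
      using C N m c by (intro psd_add psd_tensor_C_AB psd_R_map) (auto simp: is_state_def)
    ultimately show ?thesis by (simp add: c_def)
  qed
qed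

section \<open>Real linearity and the passage to mixtures\<close>

lemma Phi_R_zero: "Phi_R c 0 = 0"
  by (auto simp: vec_eq_iff Phi_R_def on_A_def on_B_def on_C_def R_map_def trace_def mat_def)

lemma Phi_R_add: "Phi_R c (X + Y) = Phi_R c X + Phi_R c Y"
  by (auto simp: vec_eq_iff Phi_R_def on_A_def on_B_def on_C_def R_map_def trace_def mat_def
      sum.distrib algebra_simps)

lemma Phi_R_scaleR: "Phi_R c (r *\<^sub>R X) = r *\<^sub>R Phi_R c X"
  by (auto simp: vec_eq_iff Phi_R_def on_A_def on_B_def on_C_def R_map_def trace_def mat_def
      scaleR_sum_right[symmetric] scaleR_add_right scaleR_diff_right mult.commute)

lemma Phi_R_sum: "Phi_R c (\<Sum>k\<in>K. X k) = (\<Sum>k\<in>K. Phi_R c (X k))"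
  by (induction K rule: infinite_finite_induct) (auto simp: Phi_R_zero Phi_R_add)

theorem theorem5:
  fixes \<rho> :: "('d::finite \<times> 'd \<times> 'd) cmat"
  assumes "CARD('d) \<ge> 2"
    and "is_state \<rho>"
    and "biseparable \<rho>"
  shows "psd (Phi_R (2 / real CARD('d)) \<rho>)"
proof -
  obtain n p \<omega> where "\<And>k. k < n \<Longrightarrow> 0 \<le> p k \<and> product_state (\<omega> k)"
      and "\<rho> = (\<Sum>k<n::nat. p k *\<^sub>R \<omega> k)"
    using assms(3) unfolding biseparable_def by blast
  \<comment> \<open>By real linearity the image of the mixture is the same nonnegative combination
    of the images of the product states.\<close>
  thus ?thesis
    using assms(1)
    by (auto simp: Phi_R_sum Phi_R_scaleR intro!: psd_sum psd_scaleR psd_Phi_R_product_state)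
qed

end
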